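(* Let $L$ be a finite-dimensional Leibniz algebra over $\mathbb{C}$ which admits an automorphism of prime order with no nonzero fixed points. Then $L$ is a nilpotent algebra.
   Context: A (right) Leibniz algebra over a field $F$ is an $F$-vector space $L$ with a bilinear multiplication $[-,-]$ satisfying $[[x,y],z]=[[x,z],y]+[x,[y,z]]$ for all $x,y,z\in L$. An automorphism of $L$ is a bijective linear map $A\colon L\to L$ with $A([x,y])=[A(x),A(y)]$ for all $x,y\in L$. It has prime order if its order in the automorphism group of $L$ is a prime number. The lower central series is defined by $L^1=L$ and $L^{n+1}=[L^n,L]$ for $n\ge 1$, where $[U,V]$ denotes the linear span of all products $[u,v]$ with $u\in U$, $v\in V$; $L$ is nilpotent if $L^k=0$ for some $k\in\mathbb{N}$. *)

theory Defs
  imports Complex_Main "HOL-Computational_Algebra.Primes" "HOL-Algebra.Multiplicative_Group"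
begin

text \<open>Right Leibniz algebras over an arbitrary field. The vector space is the whole type \<open>'b\<close>,
  following the library locale \<^locale>\<open>vector_space\<close>.\<close>

locale leibniz_algebra = vector_space scale
  for scale :: "'a::field \<Rightarrow> 'b::ab_group_add \<Rightarrow> 'b" +
  fixes bracket :: "'b \<Rightarrow> 'b \<Rightarrow> 'b"
  assumes linear_bracket_left: "Vector_Spaces.linear scale scale (\<lambda>x. bracket x y)"
    and linear_bracket_right: "Vector_Spaces.linear scale scale (\<lambda>y. bracket x y)"
    and leibniz_identity:
      "bracket (bracket x y) z = bracket (bracket x z) y + bracket x (bracket y z)"
begin

definition automorphism :: "('b \<Rightarrow> 'b) \<Rightarrow> bool" where
  "automorphism A \<longleftrightarrow> Vector_Spaces.linear scale scale A \<and> bij A \<and>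
     (\<forall>x y. A (bracket x y) = bracket (A x) (A y))"

definition automorphism_group :: "('b \<Rightarrow> 'b) monoid" where
  "automorphism_group = \<lparr>carrier = {A. automorphism A}, mult = (\<circ>), one = id\<rparr>"

text \<open>In \<^theory>\<open>HOL-Algebra.Multiplicative_Group\<close>, \<open>ord\<close> takes the value \<open>0\<close> on elements of
  infinite order, so a prime value of \<open>ord\<close> entails finite order.\<close>

definition has_prime_order :: "('b \<Rightarrow> 'b) \<Rightarrow> bool" where
  "has_prime_order A \<longleftrightarrow> Factorial_Ring.prime (group.ord automorphism_group A)"

definition product_space :: "'b set \<Rightarrow> 'b set \<Rightarrow> 'b set" where
  "product_space U V = span {bracket u v | u v. u \<in> U \<and> v \<in> V}"

text \<open>The series is indexed from \<open>1\<close>; the value at \<open>0\<close> is a dummy, which is why nilpotency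
  asks for \<open>k \<ge> 1\<close>.\<close>

fun lower_central :: "nat \<Rightarrow> 'b set" where
  "lower_central 0 = UNIV"
| "lower_central (Suc 0) = UNIV"
| "lower_central (Suc (Suc n)) = product_space (lower_central (Suc n)) UNIV"

definition nilpotent :: bool where
  "nilpotent \<longleftrightarrow> (\<exists>k\<ge>1. lower_central k = {0})"

lemma automorphism_id: "automorphism id"
  using linear_id by (simp add: automorphism_def)

lemma automorphism_comp:
  assumes "automorphism A" "automorphism B"
  shows "automorphism (A \<circ> B)"
  using assms Vector_Spaces.linear_compose
  by (auto simp: automorphism_def bij_comp)

lemma automorphism_inv:
  assumes "automorphism A"
  shows "automorphism (inv_into UNIV A)"
proof -
  let ?B = "inv_into UNIV A"
  have lin: "Vector_Spaces.linear scale scale A" and bij: "bij A"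
    and mult: "\<And>x y. A (bracket x y) = bracket (A x) (A y)"
    using assms by (auto simp: automorphism_def)
  interpret A: Vector_Spaces.linear scale scale A by (fact lin)
  have AB: "A (?B x) = x" for x using bij by (simp add: bij_is_surj surj_f_inv_f)
  have BA: "?B (A x) = x" for x using bij by (simp add: bij_is_inj)
  have "?B (x + y) = ?B x + ?B y" for x y
    by (metis AB BA A.add)
  moreover have "?B (scale c x) = scale c (?B x)" for c x
    by (metis AB BA A.scale)
  ultimately have "Vector_Spaces.linear scale scale ?B"
    by (unfold_locales) auto
  moreover have "bij ?B" using bij by (rule bij_imp_bij_inv)
  moreover have "?B (bracket x y) = bracket (?B x) (?B y)" for x y
    by (metis AB BA mult)
  ultimately show ?thesis by (simp add: automorphism_def)
qed

lemma group_automorphism_group: "group automorphism_group"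
proof (rule groupI)
  fix A assume "A \<in> carrier automorphism_group"
  then have A: "automorphism A" by (simp add: automorphism_group_def)
  then have "inv_into UNIV A \<circ> A = id"
    by (auto simp: automorphism_def bij_is_inj)
  with automorphism_inv[OF A]
  show "\<exists>B\<in>carrier automorphism_group.
      B \<otimes>\<^bsub>automorphism_group\<^esub> A = \<one>\<^bsub>automorphism_group\<^esub>"
    by (auto simp: automorphism_group_def)
qed (auto simp: automorphism_group_def automorphism_id automorphism_comp comp_assoc)

end

end

theory Submission
  imports Defs
begin

text \<open>The automorphism \<open>A\<close> of order \<open>p\<close> is diagonalizable and its eigenvalues are \<open>p\<close>-th roots of unity
  other than \<open>1\<close>. If \<open>h\<close> is an eigenvector for \<open>c\<close> and \<open>y\<close> one for \<open>d\<close>, then \<open>A\<close> multiplies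
  \<open>[...[y,h],...,h]\<close> (with \<open>n\<close> factors \<open>h\<close>) by \<open>d c\<^sup>n\<close>. As \<open>p\<close> is prime, \<open>c\<close> generates all \<open>p\<close>-th roots
  of unity, so \<open>d c\<^sup>n = 1\<close> for some \<open>n < p\<close> and the product is a fixed point, hence \<open>0\<close>. Thus right
  multiplication by each eigenvector is nilpotent. The eigenvectors span \<open>L\<close> and are closed under the
  bracket, so a Leibniz version of the Engel-Jacobson theorem on weakly closed sets of nilpotent
  operators gives nilpotency of \<open>L\<close>: a subspace of maximal dimension among those that are
  spanned by eigenvectors and the right annihilator and act nilpotently from the right must be \<open>L\<close>,
  for otherwise it is normalized by some eigenvector outside of it, which can be adjoined.\<close>

context leibniz_algebra
begin

section \<open>Bilinearity and iterated right multiplication\<close>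

lemma bracket_add_left: "bracket (x + y) z = bracket x z + bracket y z"
  and bracket_scale_left: "bracket (scale c x) z = scale c (bracket x z)"
  and bracket_zero_left: "bracket 0 z = 0"
proof -
  interpret l: Vector_Spaces.linear scale scale "\<lambda>x. bracket x z"
    by (rule linear_bracket_left)
  show "bracket (x + y) z = bracket x z + bracket y z"
    "bracket (scale c x) z = scale c (bracket x z)" "bracket 0 z = 0"
    by (fact l.add l.scale l.zero)+
qed

lemma bracket_add_right: "bracket z (x + y) = bracket z x + bracket z y"
  and bracket_scale_right: "bracket z (scale c x) = scale c (bracket z x)"
  and bracket_zero_right: "bracket z 0 = 0"
proof -
  interpret l: Vector_Spaces.linear scale scale "\<lambda>x. bracket z x"
    by (rule linear_bracket_right)
  show "bracket z (x + y) = bracket z x + bracket z y"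
    "bracket z (scale c x) = scale c (bracket z x)" "bracket z 0 = 0"
    by (fact l.add l.scale l.zero)+
qed

definition right_mult :: "'b \<Rightarrow> 'b \<Rightarrow> 'b" where
  "right_mult y = (\<lambda>x. bracket x y)"

lemma right_mult_funpow_zero: "(right_mult y ^^ n) 0 = 0"
  by (induction n) (auto simp: right_mult_def bracket_zero_left)

lemma right_mult_funpow_add:
  "(right_mult y ^^ n) (u + v) = (right_mult y ^^ n) u + (right_mult y ^^ n) v"
  by (induction n) (auto simp: right_mult_def bracket_add_left)

lemma right_mult_funpow_scale:
  "(right_mult y ^^ n) (scale c u) = scale c ((right_mult y ^^ n) u)"
  by (induction n) (auto simp: right_mult_def bracket_scale_left)

text \<open>This and the next two lemmas let \<open>span_minimal\<close> reduce containments to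
  spanning vectors.\<close>

lemma subspace_right_mult_vimage:
  "subspace W \<Longrightarrow> subspace {x. (right_mult y ^^ n) x \<in> W}"
  by (simp add: subspace_def right_mult_funpow_zero right_mult_funpow_add
      right_mult_funpow_scale)

lemma subspace_bracket_left_vimage: "subspace W \<Longrightarrow> subspace {y. bracket x y \<in> W}"
  by (simp add: subspace_def bracket_zero_right bracket_add_right bracket_scale_right)

lemma subspace_bracket_right_vimage: "subspace W \<Longrightarrow> subspace {x. bracket x y \<in> W}"
  by (simp add: subspace_def bracket_zero_left bracket_add_left bracket_scale_left)

lemma product_space_subset:
  assumes "subspace W" "\<And>u v. u \<in> U \<Longrightarrow> v \<in> V \<Longrightarrow> bracket u v \<in> W"
  shows "product_space U V \<subseteq> W"
  unfolding product_space_def using assms by (intro span_minimal) auto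

lemma bracket_in_product_space: "u \<in> U \<Longrightarrow> v \<in> V \<Longrightarrow> bracket u v \<in> product_space U V"
  unfolding product_space_def by (auto intro!: span_base)

lemma subspace_product_space: "subspace (product_space U V)"
  by (simp add: product_space_def)

text \<open>\<open>act_series U k = {0}\<close> says that any \<open>k\<close> successive right
  multiplications by elements of \<open>U\<close> annihilate the algebra. Starting from the whole
  space rather than \<open>U\<close> measures the action on it; \<open>U = UNIV\<close> gives the
  lower central series, shifted by one.\<close>

primrec act_series :: "'b set \<Rightarrow> nat \<Rightarrow> 'b set" where
  "act_series U 0 = UNIV"
| "act_series U (Suc n) = product_space (act_series U n) U"

lemma subspace_act_series: "subspace (act_series U n)"
  by (cases n) (simp_all add: subspace_product_space)

lemma act_series_decseq: "act_series U (Suc n) \<subseteq> act_series U n"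
proof (induction n)
  case (Suc n)
  show ?case
    unfolding act_series.simps(2)[of U "Suc n"]
    by (rule product_space_subset) (use Suc in
        \<open>auto intro: subspace_product_space bracket_in_product_space\<close>)
qed simp

lemma lower_central_Suc: "lower_central (Suc n) = act_series UNIV n"
  by (induction n) simp_all

section \<open>The right annihilator and nilpotent right actions\<close>

definition right_annihilator :: "'b set" where
  "right_annihilator = {z. \<forall>x. bracket x z = 0}"

lemma subspace_right_annihilator: "subspace right_annihilator"
  by (simp add: right_annihilator_def subspace_def bracket_zero_right bracket_add_right
      bracket_scale_right)

text \<open>Adding the Leibniz identities for \<open>w, x, y\<close> and \<open>w, y, x\<close>
  cancels everything except the product of \<open>w\<close> with this sum.\<close>

lemma bracket_symm_in_right_annihilator:
  "bracket x y + bracket y x \<in> right_annihilator"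
proof -
  have "bracket w (bracket x y + bracket y x) = 0" for w
    using leibniz_identity[of w x y] leibniz_identity[of w y x]
    by (simp add: bracket_add_right add.commute)
  then show ?thesis by (simp add: right_annihilator_def)
qed

text \<open>By the Leibniz identity, right multiplication by \<open>h\<close> is a derivation, so it
  preserves each term by induction.\<close>

lemma act_series_right_mult_invariant:
  assumes "\<And>u. u \<in> U \<Longrightarrow> bracket u h \<in> U" and "x \<in> act_series U j"
  shows "bracket x h \<in> act_series U j"
proof -
  have "act_series U j \<subseteq> {x. bracket x h \<in> act_series U j}"
  proof (induction j)
    case (Suc j)
    have "bracket (bracket d u) h \<in> act_series U (Suc j)" if "d \<in> act_series U j" "u \<in> U" for d u
      unfolding leibniz_identity[of d u h]
      using that Suc assms(1)
      by (auto intro!: subspace_add subspace_product_space bracket_in_product_space)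
    then show ?case
      unfolding act_series.simps(2)[of U j]
      by (intro product_space_subset subspace_bracket_right_vimage subspace_product_space) auto
  qed simp
  then show ?thesis using assms(2) by auto
qed

text \<open>Multiply an element of \<open>act_series U j\<close> by \<open>m\<close> factors, each
  \<open>h\<close> or in \<open>U\<close>. A factor in \<open>U\<close> moves the product to the
  next term, which \<open>h\<close> preserves; if all factors are \<open>h\<close>, the product is
  zero.\<close>

lemma act_series_extend:
  assumes norm: "\<And>u. u \<in> U \<Longrightarrow> bracket u h \<in> U"
    and nil: "\<And>x. (right_mult h ^^ m) x = 0"
  shows "act_series (span (insert h U)) (j * m) \<subseteq> act_series U j"
proof (induction j)
  case (Suc j)
  let ?D = "act_series U" and ?D' = "act_series (span (insert h U))"
  \<comment> \<open>\<open>n\<close> counts how many more multiplications by \<open>h\<close>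
    suffice to reach the next term; each new factor lowers it by one, from \<open>m\<close> to
    \<open>0\<close>.\<close>
  let ?W = "\<lambda>n. ?D j \<inter> {x. (right_mult h ^^ n) x \<in> ?D (Suc j)}"
  have inv: "(right_mult h ^^ n) x \<in> ?D i" if "x \<in> ?D i" for x n i
    using that by (induction n) (auto simp: right_mult_def act_series_right_mult_invariant[OF norm])
  have W: "subspace (?W n)" for n
    by (intro subspace_inter subspace_right_mult_vimage subspace_act_series)
  have step: "?D' (j * m + i) \<subseteq> ?W (m - i)" if "i \<le> m" for i
    using that
  proof (induction i)
    case 0
    show ?case using Suc.IH nil subspace_0[OF subspace_act_series, of U "Suc j"]
      by (auto simp del: act_series.simps)
  next
    case (Suc i)
    then obtain n where n: "m - i = Suc n" "m - Suc i = n"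
      by (metis Suc_diff_Suc Suc_le_lessD)
    have IH: "?D' (j * m + i) \<subseteq> ?W (Suc n)" using Suc n by simp
    have "bracket x v \<in> ?W n" if x: "x \<in> ?D' (j * m + i)" and v: "v \<in> span (insert h U)" for x v
    proof -
      have xj: "x \<in> ?D j" and xS: "(right_mult h ^^ Suc n) x \<in> ?D (Suc j)" using IH x by auto
      have "bracket x h \<in> ?W n"
        using xj xS act_series_right_mult_invariant[OF norm]
        by (simp add: funpow_Suc_right right_mult_def del: funpow.simps act_series.simps)
      moreover have "bracket x u \<in> ?W n" if "u \<in> U" for u
      proof -
        have "bracket x u \<in> ?D (Suc j)" using that xj by (simp add: bracket_in_product_space)
        then show ?thesis using inv act_series_decseq by blast
      qed
      ultimately have "span (insert h U) \<subseteq> {v. bracket x v \<in> ?W n}"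
        by (intro span_minimal subspace_bracket_left_vimage W) auto
      then show ?thesis using v by auto
    qed
    then have "?D' (Suc (j * m + i)) \<subseteq> ?W n"
      unfolding act_series.simps(2)[of "span (insert h U)"]
      by (intro product_space_subset W)
    then show ?case using n by simp
  qed
  show ?case using step[of m] by (simp add: add.commute del: act_series.simps)
qed simp

text \<open>Modulo the right annihilator the bracket is skew-symmetric, so that a
  one-sided normalizer of a subspace containing it is two-sided.\<close>

lemma engel_step:
  assumes H: "\<And>x y. x \<in> H \<Longrightarrow> y \<in> H \<Longrightarrow> bracket x y \<in> H"
    and nil: "\<And>h. h \<in> H \<Longrightarrow> \<exists>m. \<forall>x. (right_mult h ^^ m) x = 0"
    and span_H: "span H = UNIV"
    and U: "subspace U" "right_annihilator \<subseteq> U" "U \<subseteq> span (right_annihilator \<union> (U \<inter> H))"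
    and k: "act_series U k = {0}"
    and ne: "U \<noteq> UNIV"
  obtains h k' where "h \<in> H" "h \<notin> U" "act_series (span (insert h U)) k' = {0}"
proof -
  have "\<exists>h\<in>H - U. \<forall>u\<in>U \<inter> H. bracket h u \<in> U"
  proof (rule ccontr)
    assume contra: "\<not> ?thesis"
    \<comment> \<open>Without a normalizing element, bracketing with suitable elements of
      \<open>U \<inter> H\<close> never enters \<open>U\<close>, yet descends the series to
      \<open>0\<close>, which lies in \<open>U\<close>.\<close>
    have "\<exists>h\<in>H - U. h \<in> act_series U n" for n
    proof (induction n)
      case 0
      have "\<not> H \<subseteq> U" using span_minimal[OF _ U(1)] span_H ne by blast
      then show ?case by auto
    next
      case (Suc n)
      then obtain h where h: "h \<in> H - U" "h \<in> act_series U n" by blast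
      with contra obtain u where "u \<in> U \<inter> H" "bracket h u \<notin> U" by blast
      with h H show ?case by (auto intro!: bexI[of _ "bracket h u"] bracket_in_product_space)
    qed
    from this[of k] show False using k subspace_0[OF U(1)] by auto
  qed
  then obtain h where h: "h \<in> H" "h \<notin> U" "\<And>u. u \<in> U \<inter> H \<Longrightarrow> bracket h u \<in> U" by blast
  have "span (right_annihilator \<union> (U \<inter> H)) \<subseteq> {u. bracket h u \<in> U}"
    using h(3) subspace_0[OF U(1)]
    by (intro span_minimal subspace_bracket_left_vimage U(1)) (auto simp: right_annihilator_def)
  then have hU: "bracket h u \<in> U" if "u \<in> U" for u using that U(3) by auto
  have "bracket u h \<in> U" if "u \<in> U" for u
    using subspace_diff[OF U(1) subsetD[OF U(2) bracket_symm_in_right_annihilator[of u h]] hU[OF that]]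
    by simp
  moreover obtain m where "\<And>x. (right_mult h ^^ m) x = 0" using nil[OF h(1)] by blast
  ultimately have "act_series (span (insert h U)) (k * m) \<subseteq> {0}"
    using act_series_extend[of U h m k] k by auto
  then have "act_series (span (insert h U)) (k * m) = {0}"
    using subspace_0[OF subspace_act_series] by blast
  then show ?thesis using that h by blast
qed

theorem engel_jacobson:
  assumes fd: "finite_dimensional_vector_space scale Basis"
    and H: "\<And>x y. x \<in> H \<Longrightarrow> y \<in> H \<Longrightarrow> bracket x y \<in> H"
    and nil: "\<And>h. h \<in> H \<Longrightarrow> \<exists>m. \<forall>x. (right_mult h ^^ m) x = 0"
    and span_H: "span H = UNIV"
  shows nilpotent
proof -
  interpret fd: finite_dimensional_vector_space scale Basis by (fact fd)
  \<comment> \<open>The spanning clause lets normalization be checked on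
    \<open>U \<inter> H\<close>; containing the annihilator makes it two-sided.\<close>
  define good where "good U \<longleftrightarrow> subspace U \<and> right_annihilator \<subseteq> U \<and>
    U \<subseteq> span (right_annihilator \<union> (U \<inter> H)) \<and> (\<exists>k. act_series U k = {0})" for U
  have "act_series right_annihilator 1 \<subseteq> {0}"
    unfolding One_nat_def act_series.simps
    by (rule product_space_subset) (auto simp: right_annihilator_def)
  then have "act_series right_annihilator 1 = {0}"
    using subspace_0[OF subspace_act_series] by blast
  then have "good right_annihilator"
    unfolding good_def using subspace_right_annihilator by (blast intro: span_base)
  \<comment> \<open>\<open>Suc\<close> makes the bound on dimensions strict.\<close>
  then obtain U where U: "good U" and max: "\<And>V. good V \<Longrightarrow> dim V \<le> dim U"
    using ex_has_greatest_nat[of good right_annihilator dim "Suc fd.dimension"]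
      le_imp_less_Suc[OF fd.dim_subset_UNIV] by blast
  have "U = UNIV"
  proof (rule ccontr)
    assume ne: "U \<noteq> UNIV"
    from U obtain k where k: "subspace U" "right_annihilator \<subseteq> U"
      "U \<subseteq> span (right_annihilator \<union> (U \<inter> H))" "act_series U k = {0}"
      by (auto simp: good_def)
    obtain h k' where h: "h \<in> H" "h \<notin> U" "act_series (span (insert h U)) k' = {0}"
      using engel_step[OF H nil span_H k ne] by blast
    let ?V = "span (insert h U)"
    have UV: "insert h U \<subseteq> ?V" by (rule span_superset)
    have "?V \<subseteq> span (right_annihilator \<union> (?V \<inter> H))"
    proof (rule span_minimal)
      have "span (right_annihilator \<union> (U \<inter> H)) \<subseteq> span (right_annihilator \<union> (?V \<inter> H))"
        using UV by (intro span_mono) auto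
      moreover have "h \<in> span (right_annihilator \<union> (?V \<inter> H))"
        using UV h(1) by (intro span_base) auto
      ultimately show "insert h U \<subseteq> span (right_annihilator \<union> (?V \<inter> H))" using k(3) by auto
    qed simp
    then have "good ?V" unfolding good_def using UV k(2) h(3) by auto
    moreover have "dim U < dim ?V"
      using UV h(2) k(1) by (intro fd.dim_psubset) (auto simp: span_eq_iff[THEN iffD2] span_span)
    ultimately show False using max by fastforce
  qed
  then obtain k where "act_series UNIV k = {0}" using U by (auto simp: good_def)
  then have "lower_central (Suc k) = {0}" by (simp add: lower_central_Suc)
  then show ?thesis unfolding nilpotent_def by (intro exI[of _ "Suc k"]) simp
qed

section \<open>Finite-order automorphisms and roots of unity\<close>

lemma automorphism_group_pow: "A [^]\<^bsub>automorphism_group\<^esub> (n::nat) = A ^^ n"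
  by (induction n) (simp_all add: automorphism_group_def nat_pow_def funpow_swap1 fun_eq_iff)

lemma funpow_ord_automorphism:
  assumes "automorphism A"
  shows "A ^^ group.ord automorphism_group A = id"
  using group.pow_ord_eq_1[OF group_automorphism_group, of A] assms
  by (simp add: automorphism_group_pow) (simp add: automorphism_group_def)

end

text \<open>Since \<open>p\<close> is prime, the powers of \<open>c\<close> with exponents below
  \<open>p\<close> are distinct. Being \<open>p\<close> in number, they exhaust the
  \<open>p\<close>-th roots of unity, \<open>inverse d\<close> included.\<close>

lemma root_unity_prime_power:
  fixes c d :: complex
  assumes p: "prime p" and c: "c ^ p = 1" "c \<noteq> 1" and d: "d ^ p = 1"
  obtains n where "n < p" "d * c ^ n = 1"
proof -
  have p0: "p > 0" using p prime_gt_0_nat by blast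
  have inj_aux: "c ^ i \<noteq> c ^ j" if "i < j" "j < p" for i j
  proof
    assume eq: "c ^ i = c ^ j"
    have "c \<noteq> 0" using c(1) p0 by (auto simp: power_0_left)
    have "c ^ j = c ^ i * c ^ (j - i)" using that by (simp flip: power_add)
    with eq \<open>c \<noteq> 0\<close> have 1: "c ^ (j - i) = 1" by simp
    have "coprime (j - i) p"
      using p that by (metis coprime_commute diff_le_self le_less_trans nat_dvd_not_less
          prime_imp_coprime zero_less_diff)
    moreover have "j - i \<noteq> 0" using that by simp
    ultimately obtain a b where "(j - i) * a = p * b + 1"
      using bezout_nat[of "j - i" p] by (auto simp: coprime_iff_gcd_eq_1)
    \<comment> \<open>The left side is \<open>1\<close> and the right side is
      \<open>c\<close>.\<close>
    then have "c ^ ((j - i) * a) = c ^ (p * b + 1)" by simp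
    then show False using 1 c by (simp add: power_mult power_add)
  qed
  have "inj_on (\<lambda>i. c ^ i) {..<p}"
    unfolding inj_on_def by (metis inj_aux lessThan_iff nat_neq_iff)
  then have "card ((\<lambda>i. c ^ i) ` {..<p}) = p" by (simp add: card_image)
  moreover have "(\<lambda>i. c ^ i) ` {..<p} \<subseteq> {z. z ^ p = 1}"
    using c(1) by (auto simp: power_mult[symmetric] mult.commute[of _ p]) (simp add: power_mult)
  ultimately have "(\<lambda>i. c ^ i) ` {..<p} = {z. z ^ p = 1}"
    using card_roots_unity_eq[OF p0] finite_roots_unity[of p] p0
    by (intro card_subset_eq) auto
  moreover have "inverse d \<in> {z. z ^ p = 1}" using d by (simp add: power_inverse)
  ultimately obtain n where "n < p" "inverse d = c ^ n" by blast
  moreover have "d \<noteq> 0" using d p0 by (auto simp: power_0_left)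
  ultimately show ?thesis using that by (metis right_inverse)
qed

text \<open>For a \<open>p\<close>-th root of unity \<open>u\<close>, averaging \<open>u\<^sup>j A\<^sup>j x\<close> over \<open>j < p\<close> projects \<open>x\<close> to the
  eigenspace of \<open>1/u\<close>; these projections sum up to \<open>x\<close>.\<close>

lemma span_eigenvectors_of_finite_order:
  fixes scale :: "complex \<Rightarrow> 'b::ab_group_add \<Rightarrow> 'b"
  assumes "Vector_Spaces.linear scale scale A" and p: "p > 0" and Ap: "A ^^ p = id"
  shows "module.span scale {x. \<exists>c. A x = scale c x} = UNIV"
proof -
  interpret vector_space scale using assms(1) by (rule Vector_Spaces.linear.axioms)
  interpret A: Vector_Spaces.linear scale scale A by (fact assms(1))
  have "x \<in> span {x. \<exists>c. A x = scale c x}" for x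
  proof -
    define w where "w = cis (2 * pi / p)"
    have w_pow: "w ^ j = cis (2 * pi * j / p)" for j
      by (simp add: w_def DeMoivre mult_ac)
    have wp: "w ^ p = 1" using p by (simp add: w_pow)
    have w0: "w ^ i \<noteq> 0" for i by (simp add: w_def)
    have w_neq_1: "w ^ j \<noteq> 1" if "0 < j" "j < p" for j
    proof
      assume "w ^ j = 1"
      then have "cis (2 * pi * real j / real p) = cis (2 * pi * real 0 / real p)"
        by (simp add: w_pow)
      then have "j = 0"
        by (rule inj_onD[OF bij_betw_imp_inj_on[OF bij_betw_roots_unity[OF p]]]) (use that in auto)
      with that show False by simp
    qed
    define f where "f i j = scale ((w ^ i) ^ j) ((A ^^ j) x)" for i j :: nat
    define y where "y i = (\<Sum>j<p. f i j)" for i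
    \<comment> \<open>The shift is cyclic because \<open>f i p = f i 0\<close>, so it leaves the sum
      \<open>y i\<close> unchanged.\<close>
    have f_shift: "scale (w ^ i) (A (f i j)) = f i (Suc j)" for i j
      by (simp add: f_def A.scale)
    have "scale (w ^ i) (A (y i)) = y i" for i
    proof -
      have "f i p = f i 0"
        using wp Ap by (simp add: f_def flip: power_mult) (simp add: mult.commute[of i] power_mult)
      moreover have "f i 0 + (\<Sum>j<p. f i (Suc j)) = (\<Sum>j<p. f i j) + f i p"
        using sum.lessThan_Suc_shift[of "f i" p] by simp
      ultimately show ?thesis
        by (simp add: y_def A.sum scale_sum_right f_shift)
    qed
    then have "A (y i) = scale (inverse (w ^ i)) (y i)" for i
      using w0[of i] by (metis left_inverse scale_one scale_scale)
    then have "(\<Sum>i<p. y i) \<in> span {x. \<exists>c. A x = scale c x}"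
      by (intro span_sum span_base) blast
    moreover have "(\<Sum>i<p. y i) = scale (of_nat p) x"
    proof -
      \<comment> \<open>For \<open>0 < j\<close> this is a full geometric sum with ratio
        \<open>w ^ j \<noteq> 1\<close>, hence zero.\<close>
      have "(\<Sum>i<p. f i j) = (if j = 0 then scale (of_nat p) x else 0)" if "j < p" for j
      proof -
        have "(\<Sum>i<p. (w ^ i) ^ j) = (\<Sum>i<p. (w ^ j) ^ i)"
          by (simp add: mult.commute flip: power_mult)
        also have "\<dots> = (if j = 0 then of_nat p else 0)"
        proof -
          have "(w ^ j) ^ p = 1" by (metis mult.commute power_mult power_one wp)
          then show ?thesis using w_neq_1[of j] that geometric_sum[of "w ^ j" p] by auto
        qed
        finally show ?thesis by (auto simp: f_def simp flip: scale_sum_left)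
      qed
      then have "(\<Sum>j<p. \<Sum>i<p. f i j) = scale (of_nat p) x"
        using p by simp
      then show ?thesis unfolding y_def by (subst sum.swap)
    qed
    ultimately have "scale (inverse (of_nat p)) (scale (of_nat p) x)
        \<in> span {x. \<exists>c. A x = scale c x}"
      by (metis span_scale)
    then show ?thesis using p by simp
  qed
  then show ?thesis by auto
qed

theorem theorem3p10:
  fixes scale :: "complex \<Rightarrow> 'b::ab_group_add \<Rightarrow> 'b"
    and bracket :: "'b \<Rightarrow> 'b \<Rightarrow> 'b"
  assumes "leibniz_algebra scale bracket"
    and "\<exists>Basis. finite_dimensional_vector_space scale Basis"
    and "\<exists>A. leibniz_algebra.automorphism scale bracket A \<and>
             leibniz_algebra.has_prime_order scale bracket A \<and>
             (\<forall>x. A x = x \<longrightarrow> x = 0)"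
  shows "leibniz_algebra.nilpotent scale bracket"
proof -
  interpret leibniz_algebra scale bracket by (fact assms(1))
  obtain Basis where fd: "finite_dimensional_vector_space scale Basis" using assms(2) by blast
  obtain A where aut: "automorphism A" and po: "has_prime_order A"
    and fpf: "\<And>x. A x = x \<Longrightarrow> x = 0" using assms(3) by blast
  interpret A: Vector_Spaces.linear scale scale A using aut by (simp add: automorphism_def)
  have A_bracket: "A (bracket x y) = bracket (A x) (A y)" for x y
    using aut by (simp add: automorphism_def)
  define p where "p = group.ord automorphism_group A"
  have p: "prime p" using po by (simp add: has_prime_order_def p_def)
  then have p0: "p > 0" by (rule prime_gt_0_nat)
  have Ap: "A ^^ p = id" using funpow_ord_automorphism[OF aut] by (simp add: p_def)
  define H where "H = {x. \<exists>c. A x = scale c x}"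
  have span_H: "span H = UNIV"
    unfolding H_def using span_eigenvectors_of_finite_order[OF A.linear_axioms p0 Ap] .
  have eigenvalue: "c ^ p = 1" if "A x = scale c x" "x \<noteq> 0" for c x
  proof -
    have "(A ^^ n) x = scale (c ^ n) x" for n
      by (induction n) (simp_all add: that(1) A.scale mult.commute)
    from this[of p] have "scale (c ^ p) x = scale 1 x" using Ap by simp
    then show ?thesis using that(2) by (simp only: scale_cancel_right) simp
  qed
  have H: "bracket x y \<in> H" if "x \<in> H" "y \<in> H" for x y
    using that by (auto simp: H_def A_bracket bracket_scale_left bracket_scale_right)
  have "(right_mult h ^^ p) x = 0" if h: "h \<in> H" for h x
  proof (cases "h = 0")
    case True
    then show ?thesis using p0
      by (cases p) (auto simp: right_mult_def bracket_zero_right)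
  next
    case False
    from h obtain c where c: "A h = scale c h" by (auto simp: H_def)
    have cp: "c ^ p = 1" "c \<noteq> 1" using eigenvalue[OF c False] fpf[of h] c False by auto
    have "(right_mult h ^^ p) y = 0" if "y \<in> H" for y
    proof (cases "y = 0")
      case False
      from \<open>y \<in> H\<close> obtain d where d: "A y = scale d y" by (auto simp: H_def)
      have A_pow: "A ((right_mult h ^^ n) y) = scale (d * c ^ n) ((right_mult h ^^ n) y)" for n
        by (induction n) (simp_all add: d c right_mult_def A_bracket bracket_scale_left
            bracket_scale_right mult_ac)
      obtain n where n: "n < p" "d * c ^ n = 1"
        using root_unity_prime_power[OF p cp eigenvalue[OF d False]] .
      then have "(right_mult h ^^ n) y = 0" using fpf A_pow[of n] by simp
      \<comment> \<open>Here \<open>n\<close> depends on \<open>y\<close>; padding to the uniform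
        exponent \<open>p\<close> allows extension to the span of \<open>H\<close>.\<close>
      then have "(right_mult h ^^ (p - n + n)) y = 0"
        by (simp add: funpow_add right_mult_funpow_zero)
      then show ?thesis using n by simp
    qed (simp add: right_mult_funpow_zero)
    then have "span H \<subseteq> {x. (right_mult h ^^ p) x \<in> {0}}"
      by (intro span_minimal subspace_right_mult_vimage) auto
    then show ?thesis using span_H by auto
  qed
  then show ?thesis using engel_jacobson[OF fd H _ span_H] by blast
qed

end
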